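(* The set $\mathrm{Sort}(132)$ of $132$-sortable permutations satisfies $$\mathrm{Sort}(132)=\mathfrak{S}(2314,\mu),$$ where $\mu$ is the mesh pattern $\mu=(132,\{(0,2),(2,0),(2,1)\})$.
   Context: A permutation contains a classical pattern $\tau$ if some subsequence is order isomorphic to $\tau$; otherwise it avoids $\tau$. An occurrence of the mesh pattern $\mu$ in a permutation $\pi$ is a subsequence $a\,c\,b$ of $\pi$ (in this order of positions) with $a<b<c$ such that: every element preceding $a$ in $\pi$ is either smaller than $b$ or greater than $c$; and every element positioned between $c$ and $b$ in $\pi$ is greater than $b$. A permutation avoids $\mu$ if it has no occurrence of $\mu$. $\mathfrak{S}(2314,\mu)$ is the set of all permutations avoiding both $2314$ and $\mu$. For a permutation $\sigma$ of length at least $2$, the $\sigma$-stack acts on an input permutation $\pi=\pi_1\cdots\pi_n$ as follows (starting with empty stack and output). For $i=1,\dots,n$: as long as pushing $\pi_i$ on top of the stack would make the content of the stack, read from top to bottom, contain an occurrence of $\sigma$, pop the top element and append it to the output; then push $\pi_i$. After all letters have been pushed, pop all remaining elements, from top to bottom, appending them to the output. The resulting output is denoted $\mathcal{S}^{\sigma}(\pi)$. The permutation $\pi$ of length $n$ is $\sigma$-sortable if $\mathcal{S}^{21}(\mathcal{S}^{\sigma}(\pi))=12\cdots n$. $\mathrm{Sort}(\sigma)$ is the set of $\sigma$-sortable permutations. *)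

theory Defs
  imports "HOL-Library.Sublist" "HOL-Combinatorics.Multiset_Permutations"
begin

text \<open>Permutations of length \<open>n\<close> in one-line notation are the lists in
  \<open>permutations_of_set {1..n}\<close>.\<close>

definition perms :: "nat list set" where
  "perms = (\<Union>n. permutations_of_set {1..n})"

definition order_isomorphic :: "nat list \<Rightarrow> nat list \<Rightarrow> bool" where
  "order_isomorphic xs ys \<longleftrightarrow> length xs = length ys \<and>
     (\<forall>i<length xs. \<forall>j<length xs. xs ! i < xs ! j \<longleftrightarrow> ys ! i < ys ! j)"

definition contains :: "nat list \<Rightarrow> nat list \<Rightarrow> bool" where
  "contains xs \<tau> \<longleftrightarrow> (\<exists>ys. subseq ys xs \<and> order_isomorphic ys \<tau>)"

text \<open>A mesh pattern is a pair of a classical pattern and a set of shaded boxes; the box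
  \<open>(u, v)\<close> is the open unit square with lower left corner \<open>(u, v)\<close>.
  An occurrence is given by its increasing list of (0-based) positions \<open>ps\<close>. An entry
  \<open>\<pi> ! q\<close> outside the occurrence lies in box \<open>(u, v)\<close> if exactly \<open>u\<close> entries of the occurrence
  are to its left and exactly \<open>v\<close> entries of the occurrence are smaller than it.\<close>

definition mesh_occurrence ::
    "nat list \<Rightarrow> nat list \<times> (nat \<times> nat) set \<Rightarrow> nat list \<Rightarrow> bool" where
  "mesh_occurrence \<pi> \<mu> ps \<longleftrightarrow>
     sorted_wrt (<) ps \<and> set ps \<subseteq> {..<length \<pi>} \<and>
     order_isomorphic (map ((!) \<pi>) ps) (fst \<mu>) \<and>
     (\<forall>q<length \<pi>. q \<notin> set ps \<longrightarrow>
        (card {p \<in> set ps. p < q}, card {p \<in> set ps. \<pi> ! p < \<pi> ! q}) \<notin> snd \<mu>)"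

definition mesh_contains :: "nat list \<Rightarrow> nat list \<times> (nat \<times> nat) set \<Rightarrow> bool" where
  "mesh_contains \<pi> \<mu> \<longleftrightarrow> (\<exists>ps. mesh_occurrence \<pi> \<mu> ps)"

definition mu :: "nat list \<times> (nat \<times> nat) set" where
  "mu = ([1, 3, 2], {(0, 2), (2, 0), (2, 1)})"

text \<open>\<open>stack_run \<sigma> xs st\<close> is the output still to be produced when the remaining input is \<open>xs\<close>
  and the stack content, read from top to bottom, is \<open>st\<close>. Pushing on the empty stack is always
  allowed, since only \<open>\<sigma>\<close> of length at least 2 are considered.\<close>

fun stack_run :: "nat list \<Rightarrow> nat list \<Rightarrow> nat list \<Rightarrow> nat list" where
  "stack_run \<sigma> [] st = st"
| "stack_run \<sigma> (x # xs) [] = stack_run \<sigma> xs [x]"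
| "stack_run \<sigma> (x # xs) (t # st) =
     (if contains (x # t # st) \<sigma> then t # stack_run \<sigma> (x # xs) st
      else stack_run \<sigma> xs (x # t # st))"

definition stack_output :: "nat list \<Rightarrow> nat list \<Rightarrow> nat list" where
  "stack_output \<sigma> \<pi> = stack_run \<sigma> \<pi> []"

definition Sort :: "nat list \<Rightarrow> nat list set" where
  "Sort \<sigma> = {\<pi> \<in> perms. stack_output [2, 1] (stack_output \<sigma> \<pi>) = [1..<Suc (length \<pi>)]}"

lemma mesh_contains_mu_iff:
  assumes "distinct \<pi>"
  shows "mesh_contains \<pi> mu \<longleftrightarrow>
    (\<exists>i j k. i < j \<and> j < k \<and> k < length \<pi> \<and> \<pi> ! i < \<pi> ! k \<and> \<pi> ! k < \<pi> ! j \<and>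
       (\<forall>q<i. \<pi> ! q < \<pi> ! k \<or> \<pi> ! j < \<pi> ! q) \<and>
       (\<forall>q. j < q \<and> q < k \<longrightarrow> \<pi> ! k < \<pi> ! q))"
proof -
  have char: "mesh_occurrence \<pi> mu [i, j, k] \<longleftrightarrow>
      i < j \<and> j < k \<and> k < length \<pi> \<and> \<pi> ! i < \<pi> ! k \<and> \<pi> ! k < \<pi> ! j \<and>
       (\<forall>q<i. \<pi> ! q < \<pi> ! k \<or> \<pi> ! j < \<pi> ! q) \<and>
       (\<forall>q. j < q \<and> q < k \<longrightarrow> \<pi> ! k < \<pi> ! q)" (is "_ \<longleftrightarrow> ?R") for i j k
  proof -
    have iso: "order_isomorphic (map ((!) \<pi>) [i, j, k]) [1, 3, 2] \<longleftrightarrow>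
        \<pi> ! i < \<pi> ! k \<and> \<pi> ! k < \<pi> ! j"
      by (auto simp: order_isomorphic_def less_Suc_eq numeral_3_eq_3 All_less_Suc2)
    have box: "(\<forall>q<length \<pi>. q \<notin> set [i, j, k] \<longrightarrow>
        (card {p \<in> set [i, j, k]. p < q}, card {p \<in> set [i, j, k]. \<pi> ! p < \<pi> ! q}) \<notin> snd mu) \<longleftrightarrow>
        (\<forall>q<i. \<pi> ! q < \<pi> ! k \<or> \<pi> ! j < \<pi> ! q) \<and>
        (\<forall>q. j < q \<and> q < k \<longrightarrow> \<pi> ! k < \<pi> ! q)" (is "?B \<longleftrightarrow> ?C")
      if h: "i < j" "j < k" "k < length \<pi>" "\<pi> ! i < \<pi> ! k" "\<pi> ! k < \<pi> ! j"
    proof -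
      have cp: "card {p \<in> set [i, j, k]. P p} =
          (if P i then 1 else 0) + (if P j then 1 else 0) + (if P k then 1 else 0)" for P
      proof -
        have "card {p \<in> set [i, j, k]. P p} = (\<Sum>p\<in>{i, j, k}. if P p then 1 else 0)"
          by (simp add: sum.If_cases Int_def conj_commute)
        then show ?thesis using h by simp
      qed
      have pt: "((card {p \<in> set [i, j, k]. p < q},
            card {p \<in> set [i, j, k]. \<pi> ! p < \<pi> ! q}) \<notin> snd mu) \<longleftrightarrow>
          (q < i \<longrightarrow> \<pi> ! q < \<pi> ! k \<or> \<pi> ! j < \<pi> ! q) \<and>
          (j < q \<and> q < k \<longrightarrow> \<pi> ! k < \<pi> ! q)"
        if q: "q < length \<pi>" "q \<notin> set [i, j, k]" for q
      proof -
        have "\<pi> ! q \<noteq> \<pi> ! i" "\<pi> ! q \<noteq> \<pi> ! j" "\<pi> ! q \<noteq> \<pi> ! k"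
          using assms q h by (auto simp: nth_eq_iff_index_eq)
        then show ?thesis
          using h q unfolding cp by (auto simp: mu_def split: if_splits)
      qed
      show ?thesis
      proof
        assume B: ?B
        have "\<pi> ! q < \<pi> ! k \<or> \<pi> ! j < \<pi> ! q" if "q < i" for q
          using B pt[of q] that h by auto
        moreover have "\<pi> ! k < \<pi> ! q" if "j < q" "q < k" for q
          using B pt[of q] that h by auto
        ultimately show ?C by blast
      next
        assume ?C
        then show ?B using pt by blast
      qed
    qed
    have "fst mu = [1, 3, 2]" by (simp add: mu_def)
    then show ?thesis
      unfolding mesh_occurrence_def using iso box by auto
  qed
  have "mesh_contains \<pi> mu \<longleftrightarrow> (\<exists>i j k. mesh_occurrence \<pi> mu [i, j, k])"
  proof
    assume "mesh_contains \<pi> mu"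
    then obtain ps where ps: "mesh_occurrence \<pi> mu ps" by (auto simp: mesh_contains_def)
    then have "length ps = 3"
      by (auto simp: mesh_occurrence_def order_isomorphic_def mu_def)
    then obtain i j k where "ps = [i, j, k]"
      by (auto simp: numeral_3_eq_3 length_Suc_conv)
    with ps show "\<exists>i j k. mesh_occurrence \<pi> mu [i, j, k]" by blast
  qed (auto simp: mesh_contains_def)
  then show ?thesis by (simp only: char)
qed

end

theory Submission
  imports Defs
begin

text \<open>The classical stack sorts a permutation exactly when it avoids 231, so \<open>\<pi>\<close> is sortable iff the
  output of its 132-stack avoids 231. The proof turns this into a condition on single pairs of
  entries and then reads the two patterns off the run of the stack.

  A stack that avoids 132 from top to bottom never releases a left-to-right minimum before the
  input ends (\<open>min_in_stack\<close>), while the arrival of such a minimum expels all non-minima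
  (\<open>minimum_keeps_only_minima\<close>). The output is therefore an arrangement of the non-minima
  followed by the minima in increasing order. Since 1 comes after all non-minima, an ascent among
  the non-minima completes to a 231, and there is no other way to obtain a 231. So \<open>\<pi>\<close> is
  sortable iff no two non-minima \<open>u < v\<close> leave the stack in this order, an \<open>ascent_pair\<close>
  (\<open>output_has_231_iff\<close>).

  Patterns produce ascent pairs. In an occurrence \<open>b c a d\<close> of 2314, the entries \<open>b\<close> and \<open>c\<close>
  cannot both lie below \<open>a\<close> on the stack, so one of them has left before \<open>d\<close> enters. In an
  occurrence \<open>a c b\<close> of \<open>mu\<close>, if \<open>c\<close> is still on the stack when \<open>b\<close> enters, then \<open>b\<close> leaves
  before \<open>c\<close>. If not, some \<open>x \<ge> b\<close> has expelled \<open>c\<close>, and the pop ended at a pair \<open>l, y\<close> with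
  \<open>x < y < l\<close> in which \<open>y\<close> stayed. Either \<open>y\<close> is not a minimum and \<open>x, y\<close> is an ascent pair, or
  \<open>y\<close> precedes \<open>a\<close>, the shading to the left of \<open>a\<close> gives \<open>c < y < l\<close>, and \<open>c, l\<close> is one.

  Conversely let \<open>u, v\<close> be an ascent pair. If \<open>u\<close> lies above \<open>v\<close> on the stack, take the first
  entry \<open>w < v\<close> after \<open>v\<close>, and the smallest entry \<open>m\<close> before \<open>v\<close>. Then \<open>m v w\<close> is an occurrence of
  \<open>mu\<close>, unless some \<open>y\<close> between \<open>w\<close> and \<open>v\<close> in value precedes \<open>m\<close>; such a \<open>y\<close> must have been
  popped, hence is not a minimum, and starts a 2314 (\<open>larger_below_imp_pattern\<close>). If \<open>u\<close> is
  popped before \<open>v\<close> enters, the entries \<open>y, z\<close> that forced the pop, together with the incoming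
  letter \<open>x\<close> and \<open>v\<close>, form a 2314 \<open>y z x v\<close>, or else \<open>z > u\<close> lies below \<open>u\<close> and the previous case
  applies.\<close>

section \<open>Relative position in a list\<close>

primrec before :: "'a list \<Rightarrow> 'a \<Rightarrow> 'a \<Rightarrow> bool" where
  "before [] x y \<longleftrightarrow> False"
| "before (z # zs) x y \<longleftrightarrow> (x = z \<and> y \<in> set zs) \<or> before zs x y"

lemma before_append [simp]:
  "before (xs @ ys) x y \<longleftrightarrow> before xs x y \<or> before ys x y \<or> (x \<in> set xs \<and> y \<in> set ys)"
  by (induction xs) auto

lemma before_in_set: "before xs x y \<Longrightarrow> x \<in> set xs \<and> y \<in> set xs"
  by (induction xs) auto

lemma before_rev [simp]: "before (rev xs) x y \<longleftrightarrow> before xs y x"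
  by (induction xs) auto

lemma before_split: "before xs x y \<Longrightarrow> \<exists>us vs. xs = us @ x # vs \<and> y \<in> set vs"
proof (induction xs)
  case (Cons z zs)
  show ?case
  proof (cases "x = z \<and> y \<in> set zs")
    case True
    then show ?thesis by (metis append_Nil)
  next
    case False
    with Cons obtain us vs where "zs = us @ x # vs" "y \<in> set vs" by auto
    then show ?thesis by (metis append_Cons)
  qed
qed simp

lemma before_subseq: "subseq xs ys \<Longrightarrow> before xs x y \<Longrightarrow> before ys x y"
  by (induction rule: list_emb.induct) (auto dest: list_emb_set)

lemma before_nth:
  "before xs x y \<longleftrightarrow> (\<exists>i j. i < j \<and> j < length xs \<and> xs ! i = x \<and> xs ! j = y)"
proof
  assume "before xs x y"
  then obtain us vs where xs: "xs = us @ x # vs" and "y \<in> set vs"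
    using before_split by fast
  then obtain k where "k < length vs" "vs ! k = y" by (auto simp: in_set_conv_nth)
  then show "\<exists>i j. i < j \<and> j < length xs \<and> xs ! i = x \<and> xs ! j = y"
    using xs by (intro exI[of _ "length us"] exI[of _ "length us + Suc k"])
      (auto simp: nth_append)
next
  assume "\<exists>i j. i < j \<and> j < length xs \<and> xs ! i = x \<and> xs ! j = y"
  then obtain i j where ij: "i < j" "j < length xs" "xs ! i = x" "xs ! j = y" by blast
  then have "xs = take i xs @ x # drop (Suc i) xs" using id_take_nth_drop[of i xs] by simp
  moreover have "y \<in> set (drop (Suc i) xs)"
    unfolding in_set_conv_nth using ij by (intro exI[of _ "j - Suc i"]) auto
  ultimately show "before xs x y"
    by (metis before.simps(2) before_append)
qed

lemma before_trans: "distinct xs \<Longrightarrow> before xs x y \<Longrightarrow> before xs y z \<Longrightarrow> before xs x z"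
  by (induction xs) (auto dest: before_in_set)

lemma before_asym: "distinct xs \<Longrightarrow> before xs x y \<Longrightarrow> \<not> before xs y x"
  by (induction xs) (auto dest: before_in_set)

lemma before_total: "x \<in> set xs \<Longrightarrow> y \<in> set xs \<Longrightarrow> x \<noteq> y \<Longrightarrow> before xs x y \<or> before xs y x"
  by (induction xs) auto

lemma before_prefix:
  "distinct (ps @ xs) \<Longrightarrow> v \<in> set ps \<Longrightarrow> before (ps @ xs) y v \<longleftrightarrow> before ps y v"
  by (auto dest: before_in_set)

text \<open>Entries of a duplicate-free list are linearly ordered by position, so a subsequence is determined
  by the relative position of consecutive entries. Occurrences of patterns thereby become chains
  of \<open>before\<close> facts.\<close>

lemma subseq_Cons_Cons_iff_before:
  "distinct xs \<Longrightarrow> subseq (x # y # ys) xs \<longleftrightarrow> before xs x y \<and> subseq (y # ys) xs"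
proof (induction xs)
  case (Cons z zs)
  have "y \<in> set zs" if "subseq (y # ys) zs"
    using list_emb_set[OF that, of y] by auto
  then show ?case
    using Cons by (cases "x = z"; cases "y = z") (auto dest: before_in_set subseq_Cons')
qed simp

lemma subseq_pair: "subseq [x, y] xs \<longleftrightarrow> before xs x y"
  by (induction xs) (auto simp: subseq_singleton_left dest: before_in_set subseq_Cons')

section \<open>Patterns as configurations of values\<close>

lemma contains_21: "contains xs [2, 1] \<longleftrightarrow> (\<exists>b a. before xs b a \<and> a < b)"
proof -
  have iso: "order_isomorphic ys [2, 1] \<longleftrightarrow> (\<exists>b a. ys = [b, a] \<and> a < b)" for ys
  proof (cases "length ys = 2")
    case False
    then have "\<not> order_isomorphic ys [2, 1]" by (simp add: order_isomorphic_def)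
    with False show ?thesis by fastforce
  next
    case True
    then obtain b a where "ys = [b, a]" by (auto simp: length_Suc_conv numeral_eq_Suc)
    then show ?thesis by (simp add: order_isomorphic_def numeral_eq_Suc All_less_Suc2) auto
  qed
  show ?thesis
    unfolding contains_def iso subseq_pair[symmetric] by blast
qed

lemma contains_132:
  assumes "distinct xs"
  shows "contains xs [1, 3, 2] \<longleftrightarrow>
    (\<exists>a c b. before xs a c \<and> before xs c b \<and> a < b \<and> b < c)"
proof -
  have iso: "order_isomorphic ys [1, 3, 2] \<longleftrightarrow> (\<exists>a c b. ys = [a, c, b] \<and> a < b \<and> b < c)" for ys
  proof (cases "length ys = 3")
    case False
    then have "\<not> order_isomorphic ys [1, 3, 2]" by (simp add: order_isomorphic_def)
    with False show ?thesis by fastforce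
  next
    case True
    then obtain a c b where "ys = [a, c, b]" by (auto simp: length_Suc_conv numeral_eq_Suc)
    then show ?thesis by (simp add: order_isomorphic_def numeral_eq_Suc All_less_Suc2) auto
  qed
  have sub: "subseq [a, c, b] xs \<longleftrightarrow> before xs a c \<and> before xs c b" for a c b
    using assms by (auto simp: subseq_Cons_Cons_iff_before subseq_singleton_left dest: before_in_set)
  have "contains xs [1, 3, 2] \<longleftrightarrow> (\<exists>a c b. subseq [a, c, b] xs \<and> a < b \<and> b < c)"
    unfolding contains_def iso by blast
  then show ?thesis by (simp only: sub conj_assoc)
qed

lemma contains_2314:
  assumes "distinct xs"
  shows "contains xs [2, 3, 1, 4] \<longleftrightarrow>
    (\<exists>b c a d. before xs b c \<and> before xs c a \<and> before xs a d \<and> a < b \<and> b < c \<and> c < d)"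
proof -
  have iso: "order_isomorphic ys [2, 3, 1, 4] \<longleftrightarrow>
      (\<exists>b c a d. ys = [b, c, a, d] \<and> a < b \<and> b < c \<and> c < d)" for ys
  proof (cases "length ys = 4")
    case False
    then have "\<not> order_isomorphic ys [2, 3, 1, 4]" by (simp add: order_isomorphic_def)
    with False show ?thesis by fastforce
  next
    case True
    then have "\<exists>b c a d. ys = [b, c, a, d]"
      by (simp add: length_Suc_conv numeral_eq_Suc) blast
    then obtain b c a d where "ys = [b, c, a, d]" by blast
    moreover have "order_isomorphic [b, c, a, d] [2, 3, 1, 4] \<longleftrightarrow> a < b \<and> b < c \<and> c < d"
      unfolding order_isomorphic_def
      by (simp add: numeral_eq_Suc All_less_Suc2) (intro iffI conjI; linarith?)
    ultimately show ?thesis by simp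
  qed
  have sub: "subseq [b, c, a, d] xs \<longleftrightarrow> before xs b c \<and> before xs c a \<and> before xs a d" for b c a d
    using assms by (auto simp: subseq_Cons_Cons_iff_before subseq_singleton_left dest: before_in_set)
  have "contains xs [2, 3, 1, 4] \<longleftrightarrow> (\<exists>b c a d. subseq [b, c, a, d] xs \<and> a < b \<and> b < c \<and> c < d)"
    unfolding contains_def iso by blast
  then show ?thesis unfolding sub conj_assoc .
qed

text \<open>The shaded boxes restrict only the entries to the left of \<open>a\<close> and those between \<open>c\<close> and \<open>b\<close>,
  so the condition on positions translates into one on values.\<close>

lemma mesh_contains_mu_iff_before:
  assumes "distinct xs"
  shows "mesh_contains xs mu \<longleftrightarrow>
    (\<exists>a c b. before xs a c \<and> before xs c b \<and> a < b \<and> b < c \<and>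
       (\<forall>y. before xs y a \<longrightarrow> y < b \<or> c < y) \<and>
       (\<forall>y. before xs c y \<longrightarrow> before xs y b \<longrightarrow> b < y))"
proof -
  have nth_iff: "before xs (xs ! i) (xs ! j) \<longleftrightarrow> i < j"
    if "i < length xs" "j < length xs" for i j
    using that assms by (auto simp: before_nth nth_eq_iff_index_eq)
  have left: "(\<forall>y. before xs y (xs ! i) \<longrightarrow> P y) \<longleftrightarrow> (\<forall>q<i. P (xs ! q))"
    if "i < length xs" for i P
  proof -
    have "before xs y (xs ! i) \<longleftrightarrow> (\<exists>q<i. y = xs ! q)" for y
      using that assms by (auto simp: before_nth nth_eq_iff_index_eq)
    then show ?thesis by auto
  qed
  have mid: "(\<forall>y. before xs (xs ! j) y \<longrightarrow> before xs y (xs ! k) \<longrightarrow> P y) \<longleftrightarrow>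
      (\<forall>q. j < q \<and> q < k \<longrightarrow> P (xs ! q))"
    if "j < length xs" "k < length xs" for j k P
  proof -
    have "before xs (xs ! j) y \<and> before xs y (xs ! k) \<longleftrightarrow> (\<exists>q. j < q \<and> q < k \<and> y = xs ! q)" for y
      using that assms by (auto simp: before_nth nth_eq_iff_index_eq) fastforce+
    then show ?thesis by metis
  qed
  show ?thesis (is "_ \<longleftrightarrow> ?R")
  proof
    assume "mesh_contains xs mu"
    then obtain i j k where "i < j" "j < k" "k < length xs" "xs ! i < xs ! k" "xs ! k < xs ! j"
      "\<forall>q<i. xs ! q < xs ! k \<or> xs ! j < xs ! q" "\<forall>q. j < q \<and> q < k \<longrightarrow> xs ! k < xs ! q"
      unfolding mesh_contains_mu_iff[OF assms] by blast
    then show ?R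
      by (intro exI[of _ "xs ! i"] exI[of _ "xs ! j"] exI[of _ "xs ! k"]) (simp add: nth_iff left mid)
  next
    assume ?R
    then obtain a c b where R: "before xs a c" "before xs c b" "a < b" "b < c"
      "\<forall>y. before xs y a \<longrightarrow> y < b \<or> c < y" "\<forall>y. before xs c y \<longrightarrow> before xs y b \<longrightarrow> b < y"
      by blast
    then have "a \<in> set xs" "c \<in> set xs" "b \<in> set xs" by (auto dest: before_in_set)
    then obtain i j k where ijk: "i < length xs" "xs ! i = a" "j < length xs" "xs ! j = c"
      "k < length xs" "xs ! k = b"
      by (metis in_set_conv_nth)
    show "mesh_contains xs mu"
      unfolding mesh_contains_mu_iff[OF assms]
      using R ijk nth_iff[of i j] nth_iff[of j k] left[of i "\<lambda>y. y < b \<or> c < y"]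
        mid[of j k "\<lambda>y. b < y"]
      by (intro exI[of _ i] exI[of _ j] exI[of _ k]) auto
  qed
qed

section \<open>One pass through a stack\<close>

lemma mset_stack_run [simp]: "mset (stack_run \<sigma> xs st) = mset xs + mset st"
  by (induction \<sigma> xs st rule: stack_run.induct) auto

lemma set_stack_run [simp]: "set (stack_run \<sigma> xs st) = set xs \<union> set st"
  by (metis mset_stack_run set_mset_mset set_mset_union)

lemma distinct_stack_output [simp]: "distinct (stack_output \<sigma> \<pi>) \<longleftrightarrow> distinct \<pi>"
  by (metis add.right_neutral mset.simps(1) mset_eq_imp_distinct_iff mset_stack_run stack_output_def)

text \<open>Stacks are last in, first out: new letters only come on top, so entries already on the stack
  leave it in their order from the top.\<close>

lemma stack_order_preserved: "before st x y \<Longrightarrow> before (stack_run \<sigma> xs st) x y"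
  by (induction \<sigma> xs st rule: stack_run.induct) auto

definition has_231 :: "nat list \<Rightarrow> bool" where
  "has_231 xs \<longleftrightarrow> (\<exists>b c a. before xs b c \<and> before xs c a \<and> a < b \<and> b < c)"

text \<open>An increasing stack read from the bottom, followed by the remaining input, is a word with the same
  fate as the current state: pushing leaves it unchanged, and popping \<open>t\<close> for a larger letter \<open>x\<close>
  deletes \<open>t\<close>. The deleted entry takes part in a 231 exactly when a later letter \<open>a\<close> is smaller, in
  which case \<open>t x a\<close> is one, and this is exactly when \<open>t\<close> is output too early.\<close>

lemma sorted_stack_run_21:
  assumes "distinct (rev st @ xs)" "sorted st"
  shows "sorted (stack_run [2, 1] xs st) \<longleftrightarrow> \<not> has_231 (rev st @ xs)"
  using assms
proof (induction "[2, 1] :: nat list" xs st rule: stack_run.induct)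
  case (1 st)
  have "\<not> before st c b" if "b < c" for b c
  proof
    assume "before st c b"
    then obtain us vs where "st = us @ c # vs" "b \<in> set vs" using before_split by fast
    then show False using 1 that by (auto simp: sorted_append)
  qed
  then show ?case using 1 by (auto simp: has_231_def)
next
  case (2 x xs)
  then show ?case by simp
next
  case (3 x xs t st)
  have t: "t < y" if "y \<in> set st" for y
    using 3(3,4) that by (cases "y = t") (auto simp: le_less)
  have low: "\<not> before st c b" if "b < c" for b c
  proof
    assume "before st c b"
    then obtain us vs where "st = us @ c # vs" "b \<in> set vs" using before_split by fast
    then show False using 3(4) that by (auto simp: sorted_append)
  qed
  have cont: "contains (x # t # st) [2, 1] \<longleftrightarrow> t < x"
  proof
    assume "contains (x # t # st) [2, 1]"
    then obtain b a where "before (x # t # st) b a" "a < b"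
      unfolding contains_21 by blast
    then show "t < x" using t low by fastforce
  next
    assume "t < x"
    then show "contains (x # t # st) [2, 1]"
      unfolding contains_21 by (intro exI[of _ x] exI[of _ t]) simp
  qed
  show ?case
  proof (cases "t < x")
    case True
    have IH: "sorted (stack_run [2, 1] (x # xs) st) \<longleftrightarrow> \<not> has_231 (rev st @ x # xs)"
      using 3 True cont by simp
    have before_t: "before (rev (t # st) @ x # xs) u w \<longleftrightarrow>
        (w = t \<and> u \<in> set st) \<or> (u = t \<and> w \<in> set (x # xs)) \<or> before (rev st @ x # xs) u w"
      for u w by auto
    have t_notin: "\<not> before (rev st @ x # xs) u t" "\<not> before (rev st @ x # xs) t u" for u
      using 3(3) before_in_set[of "rev st @ x # xs"] by fastforce+
    have "has_231 (rev (t # st) @ x # xs) \<longleftrightarrow> has_231 (rev st @ x # xs) \<or> (\<exists>a\<in>set xs. a < t)"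
      (is "?L \<longleftrightarrow> ?R")
    proof
      assume ?L
      then obtain b c a where bca: "before (rev (t # st) @ x # xs) b c"
        "before (rev (t # st) @ x # xs) c a" "a < b" "b < c"
        by (auto simp: has_231_def)
      have "c \<noteq> t"
      proof
        assume "c = t"
        then have "b \<in> set st" using bca(1,4) t_notin by (auto simp: before_t dest: before_in_set)
        with \<open>c = t\<close> show False using t bca(4) by fastforce
      qed
      have "a \<noteq> t"
      proof
        assume "a = t"
        then have "c \<in> set st" using bca t_notin by (auto simp: before_t dest: before_in_set)
        moreover from this have "before st c b"
          using bca(1,4) t_notin \<open>c \<noteq> t\<close> \<open>a = t\<close> 3(3) bca(3)
          by (auto simp: before_t dest: before_in_set)
        ultimately show False using low bca(4) by blast
      qed
      have "\<exists>a\<in>set xs. a < t" if "b = t"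
      proof -
        have "before (rev st @ x # xs) c a"
          using bca(2) \<open>a \<noteq> t\<close> \<open>c \<noteq> t\<close> by (auto simp: before_t)
        then have "a \<in> set st \<or> a = x \<or> a \<in> set xs" by (auto dest: before_in_set)
        then show ?thesis using bca(3) that True t by fastforce
      qed
      moreover have "has_231 (rev st @ x # xs)" if "b \<noteq> t"
        using bca that \<open>c \<noteq> t\<close> \<open>a \<noteq> t\<close> unfolding has_231_def before_t by blast
      ultimately show ?R by blast
    next
      assume ?R
      then show ?L
      proof
        assume "has_231 (rev st @ x # xs)"
        then show ?L unfolding has_231_def before_t by blast
      next
        assume "\<exists>a\<in>set xs. a < t"
        then obtain a where "a \<in> set xs" "a < t" by blast
        then show ?L using True unfolding has_231_def before_t
          by (intro exI[of _ t] exI[of _ x] exI[of _ a]) simp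
      qed
    qed
    moreover have "sorted (stack_run [2, 1] (x # xs) (t # st)) \<longleftrightarrow>
        sorted (stack_run [2, 1] (x # xs) st) \<and> (\<forall>a\<in>set xs. \<not> a < t)"
      using True cont t by (auto simp: not_less less_imp_le)
    ultimately show ?thesis using IH by blast
  next
    case False
    have "x \<le> y" if "y \<in> set st" for y
      using False t[OF that] by linarith
    then have "sorted (x # t # st)" using 3(4) False by simp
    moreover have "stack_run [2, 1] (x # xs) (t # st) = stack_run [2, 1] xs (x # t # st)"
      using cont False by simp
    ultimately show ?thesis using 3(2,3) cont False by (simp del: stack_run.simps)
  qed
qed

lemma stack_output_21_sorts_iff:
  assumes "distinct \<pi>" "set \<pi> = {1..n}"
  shows "stack_output [2, 1] \<pi> = [1..<Suc n] \<longleftrightarrow> \<not> has_231 \<pi>"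
proof -
  have "set (stack_output [2, 1] \<pi>) = set [1..<Suc n]"
    unfolding stack_output_def set_stack_run assms(2) set_upt by auto
  then have "stack_output [2, 1] \<pi> = [1..<Suc n] \<longleftrightarrow> sorted (stack_output [2, 1] \<pi>)"
    using assms(1) sorted_upt distinct_upt
    by (metis distinct_stack_output sorted_distinct_set_unique)
  also have "\<dots> \<longleftrightarrow> \<not> has_231 \<pi>"
    unfolding stack_output_def using sorted_stack_run_21[of "[]" \<pi>] assms(1) by simp
  finally show ?thesis .
qed

section \<open>The content of the 132-stack\<close>

text \<open>What remains of the stack when \<open>x\<close> is about to be pushed onto it.\<close>

fun settle :: "nat \<Rightarrow> nat list \<Rightarrow> nat list" where
  "settle x [] = []"
| "settle x (t # st) = (if contains (x # t # st) [1, 3, 2] then settle x st else t # st)"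

definition stack_after :: "nat list \<Rightarrow> nat list" where
  "stack_after ps = foldl (\<lambda>st x. x # settle x st) [] ps"

lemma stack_after_Nil [simp]: "stack_after [] = []"
  by (simp add: stack_after_def)

lemma stack_after_snoc [simp]: "stack_after (ps @ [x]) = x # settle x (stack_after ps)"
  by (simp add: stack_after_def)

lemma settle_suffix: "\<exists>us. st = us @ settle x st"
proof (induction st)
  case (Cons t st)
  then obtain us where "st = us @ settle x st" ..
  then have "t # st = (t # us) @ settle x st" by simp
  then show ?case by (metis append_Nil settle.simps(2))
qed simp

lemma before_settle: "before (settle x st) u v \<Longrightarrow> before st u v"
  using settle_suffix[of st x] by (metis before_append)

lemma set_settle: "u \<in> set (settle x st) \<Longrightarrow> u \<in> set st"
  using settle_suffix[of st x] by (metis Un_iff set_append)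

text \<open>The stack, read from the top, reverses the order of arrival.\<close>

lemma stack_after_subseq: "subseq (stack_after ps) (rev ps)"
proof (induction ps rule: rev_induct)
  case (snoc x ps)
  have "subseq (settle x (stack_after ps)) (stack_after ps)"
    using settle_suffix by (metis list_emb_append2 subseq_order.order_refl)
  then show ?case using snoc by (auto intro: subseq_order.trans)
qed simp

lemma set_stack_after: "u \<in> set (stack_after ps) \<Longrightarrow> u \<in> set ps"
  using list_emb_set[OF stack_after_subseq, of u] by auto

lemma before_stack_after: "before (stack_after ps) u v \<Longrightarrow> before ps v u"
  using before_subseq[OF stack_after_subseq] before_rev by metis

lemma distinct_stack_after: "distinct ps \<Longrightarrow> distinct (stack_after ps)"
proof (induction ps rule: rev_induct)
  case (snoc x ps)
  then have "distinct (stack_after ps)" "x \<notin> set ps" by simp_all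
  moreover obtain us where "stack_after ps = us @ settle x (stack_after ps)"
    using settle_suffix by blast
  ultimately have "distinct (settle x (stack_after ps))" by (metis distinct_append)
  moreover have "x \<notin> set (settle x (stack_after ps))"
    using \<open>x \<notin> set ps\<close> set_settle set_stack_after by blast
  ultimately show ?case by simp
qed simp

lemma settle_avoids: "\<not> contains (x # settle x st) [1, 3, 2]"
proof (induction st)
  case Nil
  have "\<not> contains [x] [1, 3, 2]" by (subst contains_132) simp_all
  then show ?case by simp
qed simp

lemma stack_after_avoids:
  assumes "distinct ps" "before (stack_after ps) a c" "before (stack_after ps) c b" "a < b" "b < c"
  shows False
proof (cases ps rule: rev_exhaust)
  case (snoc qs x)
  then have "\<not> contains (stack_after ps) [1, 3, 2]" using settle_avoids by simp
  then show False using assms distinct_stack_after contains_132 by blast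
qed (use assms in simp)

lemma settle_pops:
  "u \<in> set st \<Longrightarrow> u \<notin> set (settle x st) \<Longrightarrow>
    \<exists>us vs. st = us @ u # vs \<and> contains (x # u # vs) [1, 3, 2]"
proof (induction st)
  case (Cons t st)
  then have c: "contains (x # t # st) [1, 3, 2]" by (auto split: if_splits)
  show ?case
  proof (cases "u = t")
    case True
    then show ?thesis using c by (metis append_Nil)
  next
    case False
    then obtain us vs where "st = us @ u # vs" "contains (x # u # vs) [1, 3, 2]"
      using Cons c by auto
    then show ?thesis by (metis append_Cons)
  qed
qed simp

text \<open>The stack before the pop avoids 132, so the occurrence of 132 that forces the pop of \<open>u\<close> starts with
  the incoming letter \<open>x\<close>.\<close>

lemma popped_witness:
  assumes "distinct (ps @ [x])" "u \<in> set (stack_after ps)" "u \<notin> set (settle x (stack_after ps))"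
  shows "\<exists>z y. (z = u \<or> before (stack_after ps) u z) \<and> before (stack_after ps) z y \<and> x < y \<and> y < z"
proof -
  obtain us vs where st: "stack_after ps = us @ u # vs" "contains (x # u # vs) [1, 3, 2]"
    using settle_pops[OF assms(2,3)] by blast
  have d: "distinct (us @ u # vs)" using assms(1) distinct_stack_after[of ps] st by simp
  have "x \<notin> set (us @ u # vs)" using assms(1) set_stack_after[of x ps] st by auto
  then have "distinct (x # u # vs)" using d by auto
  then obtain a z y where w: "before (x # u # vs) a z" "before (x # u # vs) z y" "a < y" "y < z"
    using st(2) contains_132 by blast
  have low: "before (stack_after ps) p q" if "before (u # vs) p q" for p q
    using that st(1) by auto
  show ?thesis
  proof (cases "a = x")
    case True
    then show ?thesis using w low[of z y] st(1) \<open>distinct (x # u # vs)\<close>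
      by (auto dest: before_in_set)
  next
    case False
    then have "before (stack_after ps) a z" "before (stack_after ps) z y"
      using w low \<open>distinct (x # u # vs)\<close> by (auto dest: before_in_set)
    then show ?thesis using stack_after_avoids assms(1) w(3,4) by (metis distinct_append)
  qed
qed

lemma stack_after_antimono:
  "distinct (ps @ qs) \<Longrightarrow> u \<in> set ps \<Longrightarrow> u \<in> set (stack_after (ps @ qs)) \<Longrightarrow> u \<in> set (stack_after ps)"
proof (induction qs rule: rev_induct)
  case (snoc x qs)
  then have "u \<in> set (settle x (stack_after (ps @ qs)))"
    using stack_after_snoc[of "ps @ qs" x] by auto
  then show ?case using snoc set_settle by auto
qed simp

lemma popped_at_some_time:
  "u \<in> set ps \<Longrightarrow> u \<notin> set (stack_after ps) \<Longrightarrow>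
    \<exists>qs x rs. ps = qs @ x # rs \<and> u \<in> set (stack_after qs) \<and> u \<notin> set (settle x (stack_after qs))"
proof (induction ps rule: rev_induct)
  case (snoc x ps)
  then have u: "u \<in> set ps" "u \<notin> set (settle x (stack_after ps))" by auto
  show ?case
  proof (cases "u \<in> set (stack_after ps)")
    case True
    then show ?thesis using u by blast
  next
    case False
    then obtain qs y rs where "ps = qs @ y # rs" "u \<in> set (stack_after qs)"
      "u \<notin> set (settle y (stack_after qs))"
      using snoc u by blast
    then show ?thesis by (metis append_Cons append_assoc)
  qed
qed simp

section \<open>Left-to-right minima\<close>

definition non_min :: "nat list \<Rightarrow> nat \<Rightarrow> bool" where
  "non_min xs v \<longleftrightarrow> (\<exists>y. before xs y v \<and> y < v)"

lemma non_min_in_set: "non_min xs v \<Longrightarrow> v \<in> set xs"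
  by (auto simp: non_min_def dest: before_in_set)

lemma non_min_append: "non_min ps v \<Longrightarrow> non_min (ps @ xs) v"
  by (auto simp: non_min_def)

lemma non_min_prefix: "distinct (ps @ xs) \<Longrightarrow> v \<in> set ps \<Longrightarrow> non_min (ps @ xs) v \<longleftrightarrow> non_min ps v"
  by (metis before_prefix non_min_def)

text \<open>The smallest entry in front of \<open>v\<close> is a left-to-right minimum.\<close>

lemma non_min_above_min:
  assumes "distinct xs" "non_min xs v"
  shows "\<exists>m. before xs m v \<and> m < v \<and> \<not> non_min xs m"
proof -
  define m where "m = (LEAST m. before xs m v)"
  obtain y where y: "before xs y v" "y < v" using assms(2) by (auto simp: non_min_def)
  have m: "before xs m v" unfolding m_def using y(1) by (rule LeastI)
  have least: "m \<le> z" if "before xs z v" for z unfolding m_def using that by (rule Least_le)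
  have "\<not> non_min xs m"
    unfolding non_min_def using before_trans[OF assms(1) _ m] least by fastforce
  then show ?thesis using m least[OF y(1)] y(2) by auto
qed

text \<open>Let \<open>z, y\<close> be the entries forcing a pop of the left-to-right minimum \<open>u\<close>. Then \<open>u < y\<close>, because \<open>y\<close>
  arrived before \<open>u\<close>. Hence \<open>u < y < z\<close>, and \<open>u z y\<close> would be a 132 within the stack.\<close>

lemma min_never_popped:
  assumes "distinct (ps @ [x])" "u \<in> set (stack_after ps)" "\<not> non_min ps u"
  shows "u \<in> set (settle x (stack_after ps))"
proof (rule ccontr)
  assume "u \<notin> set (settle x (stack_after ps))"
  then obtain z y where w: "z = u \<or> before (stack_after ps) u z" "before (stack_after ps) z y"
    "x < y" "y < z"
    using popped_witness assms by blast
  have d: "distinct ps" using assms(1) by simp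
  have "before (stack_after ps) u y"
    using w before_trans[OF distinct_stack_after[OF d]] by blast
  then have "before ps y u" by (rule before_stack_after)
  then have "u < y" using assms(3) d by (auto simp: non_min_def not_less le_less dest: before_asym)
  then show False using w stack_after_avoids[OF d, of u z y] by auto
qed

lemma min_in_stack:
  "distinct ps \<Longrightarrow> u \<in> set ps \<Longrightarrow> \<not> non_min ps u \<Longrightarrow> u \<in> set (stack_after ps)"
proof (induction ps rule: rev_induct)
  case (snoc x ps)
  then show ?case
    using min_never_popped[of ps x u] non_min_append[of ps u "[x]"] by auto
qed simp

lemma popped_non_min:
  "distinct (ps @ x # qs) \<Longrightarrow> u \<in> set ps \<Longrightarrow> u \<notin> set (settle x (stack_after ps)) \<Longrightarrow>
    non_min (ps @ x # qs) u"
  using min_never_popped[of ps x u] min_in_stack[of ps u] non_min_append by fastforce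

lemma kept_avoids:
  assumes "distinct (ps @ x # qs)" "before (settle x (stack_after ps)) c b" "x < b" "b < c"
  shows False
proof -
  have "distinct (ps @ [x])" using assms(1) by simp
  moreover have "before (stack_after (ps @ [x])) x c" using before_in_set[OF assms(2)] by simp
  moreover have "before (stack_after (ps @ [x])) c b" using assms(2) by simp
  ultimately show False using stack_after_avoids assms(3,4) by blast
qed

text \<open>If a left-to-right minimum \<open>x\<close> arrives while a non-minimum \<open>v\<close> is on the stack, the minimum \<open>m\<close> that
  precedes \<open>v\<close> lies below it, and \<open>x v m\<close> would be a 132.\<close>

lemma minimum_keeps_only_minima:
  assumes "distinct (ps @ x # qs)" "v \<in> set (settle x (stack_after ps))" "non_min (ps @ x # qs) v"
  shows "non_min (ps @ x # qs) x"
proof (rule ccontr)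
  assume x: "\<not> non_min (ps @ x # qs) x"
  have v: "v \<in> set ps" using assms(2) set_settle set_stack_after by blast
  then have "non_min ps v" using assms(1,3) non_min_prefix by blast
  then obtain m where m: "before ps m v" "m < v" "\<not> non_min ps m"
    using non_min_above_min assms(1) by (metis distinct_append)
  have "m \<in> set ps" using m(1) by (auto dest: before_in_set)
  then have ms: "m \<in> set (settle x (stack_after ps))"
    using popped_non_min assms(1) m(3) non_min_prefix by blast
  have "m \<noteq> v" using m by simp
  have "before (settle x (stack_after ps)) v m"
    using before_total[OF assms(2) ms] \<open>m \<noteq> v\<close> m(1) assms(1)
    by (metis before_asym before_settle before_stack_after distinct_append)
  moreover have "x < m"
  proof -
    have "before (ps @ x # qs) m x" using \<open>m \<in> set ps\<close> by simp
    then have "x \<le> m" using x by (auto simp: non_min_def)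
    moreover have "x \<noteq> m" using assms(1) \<open>m \<in> set ps\<close> by auto
    ultimately show ?thesis by simp
  qed
  ultimately show False using kept_avoids assms(1) m(2) by blast
qed

section \<open>Order of the output\<close>

lemma run_settle:
  "\<exists>out. stack_run [1, 3, 2] (x # xs) st = out @ stack_run [1, 3, 2] xs (x # settle x st) \<and>
    st = out @ settle x st"
proof (induction st)
  case (Cons t st)
  then obtain out where "stack_run [1, 3, 2] (x # xs) st = out @ stack_run [1, 3, 2] xs (x # settle x st)"
    "st = out @ settle x st" by blast
  then show ?case
    by (cases "contains (x # t # st) [1, 3, 2]") (auto intro: exI[of _ "t # out"])
qed simp

lemma run_prefix:
  "\<exists>out. stack_output [1, 3, 2] (ps @ xs) = out @ stack_run [1, 3, 2] xs (stack_after ps) \<and>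
    set ps = set out \<union> set (stack_after ps)"
proof (induction ps arbitrary: xs rule: rev_induct)
  case Nil
  then show ?case by (simp add: stack_output_def)
next
  case (snoc x ps)
  obtain out where out: "stack_output [1, 3, 2] (ps @ x # xs) =
      out @ stack_run [1, 3, 2] (x # xs) (stack_after ps)" "set ps = set out \<union> set (stack_after ps)"
    using snoc by blast
  obtain out' where "stack_run [1, 3, 2] (x # xs) (stack_after ps) =
      out' @ stack_run [1, 3, 2] xs (x # settle x (stack_after ps))"
    and st: "stack_after ps = out' @ settle x (stack_after ps)"
    using run_settle by blast
  then have "stack_output [1, 3, 2] ((ps @ [x]) @ xs) =
      (out @ out') @ stack_run [1, 3, 2] xs (stack_after (ps @ [x]))"
    using out(1) by simp
  moreover have "set (stack_after ps) = set out' \<union> set (settle x (stack_after ps))"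
    using st by (metis set_append)
  then have "set (ps @ [x]) = set (out @ out') \<union> set (stack_after (ps @ [x]))"
    using out(2) by auto
  ultimately show ?case by blast
qed

lemma output_order_stack:
  "before (stack_after ps) u v \<Longrightarrow> before (stack_output [1, 3, 2] (ps @ xs)) u v"
  using run_prefix[of ps xs] stack_order_preserved by (metis before_append)

lemma output_order_popped:
  assumes "u \<in> set ps" "u \<notin> set (stack_after ps)" "v \<in> set xs \<or> v \<in> set (stack_after ps)"
  shows "before (stack_output [1, 3, 2] (ps @ xs)) u v"
proof -
  obtain out where "stack_output [1, 3, 2] (ps @ xs) = out @ stack_run [1, 3, 2] xs (stack_after ps)"
    "set ps = set out \<union> set (stack_after ps)" using run_prefix by blast
  then show ?thesis using assms by auto
qed

text \<open>At the end of the input the stack contains all left-to-right minima, and any non-minimum \<open>y\<close> on it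
  lies above an earlier minimum \<open>m'\<close> smaller than \<open>y\<close>. A minimum \<open>m\<close> above \<open>y\<close> is smaller still, so
  \<open>m y m'\<close> would be a 132. Thus only larger minima follow \<open>m\<close> in the output.\<close>

lemma output_after_min:
  assumes "distinct \<pi>" "m \<in> set \<pi>" "\<not> non_min \<pi> m" "before (stack_output [1, 3, 2] \<pi>) m y"
  shows "\<not> non_min \<pi> y \<and> m < y"
proof -
  obtain out where out: "stack_output [1, 3, 2] \<pi> = out @ stack_after \<pi>"
    using run_prefix[of \<pi> "[]"] by auto
  have ds: "distinct (stack_after \<pi>)" using assms(1) by (rule distinct_stack_after)
  have m: "m \<in> set (stack_after \<pi>)" using assms min_in_stack by blast
  have "distinct (out @ stack_after \<pi>)" using assms(1) out by (metis distinct_stack_output)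
  then have my: "before (stack_after \<pi>) m y" using assms(4) m out by (auto dest: before_in_set)
  then have ym: "before \<pi> y m" by (rule before_stack_after)
  have "m \<noteq> y" using my ds before_asym[OF ds] by blast
  then have "m < y" using assms(3) ym by (auto simp: non_min_def not_less le_less)
  moreover have "\<not> non_min \<pi> y"
  proof
    assume "non_min \<pi> y"
    then obtain m' where m': "before \<pi> m' y" "m' < y" "\<not> non_min \<pi> m'"
      using non_min_above_min[OF assms(1)] by blast
    have m's: "m' \<in> set (stack_after \<pi>)"
      using m' min_in_stack[OF assms(1)] by (auto dest: before_in_set)
    have "y \<in> set (stack_after \<pi>)" using my by (auto dest: before_in_set)
    then have ym': "before (stack_after \<pi>) y m'"
      using before_total[OF _ m's] m' before_stack_after before_asym[OF assms(1)] by blast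
    have "before \<pi> m' m" using m'(1) ym before_trans[OF assms(1)] by blast
    moreover from this have "m \<noteq> m'" using before_asym[OF assms(1)] by blast
    ultimately have "m < m'" using assms(3) by (auto simp: non_min_def not_less le_less)
    then show False using stack_after_avoids assms(1) my ym' m'(2) by blast
  qed
  ultimately show ?thesis by blast
qed

definition ascent_pair :: "nat list \<Rightarrow> nat \<Rightarrow> nat \<Rightarrow> bool" where
  "ascent_pair \<pi> u v \<longleftrightarrow>
     non_min \<pi> u \<and> non_min \<pi> v \<and> u < v \<and> before (stack_output [1, 3, 2] \<pi>) u v"

text \<open>By \<open>output_after_min\<close>, an entry that is followed by a smaller one in the output is not a
  left-to-right minimum; conversely a minimum smaller than \<open>u\<close> comes after all non-minima and
  turns an ascent \<open>u v\<close> into a 231.\<close>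

lemma output_has_231_iff:
  assumes "distinct \<pi>"
  shows "has_231 (stack_output [1, 3, 2] \<pi>) \<longleftrightarrow> (\<exists>u v. ascent_pair \<pi> u v)"
proof
  assume "has_231 (stack_output [1, 3, 2] \<pi>)"
  then obtain b c a where w: "before (stack_output [1, 3, 2] \<pi>) b c"
    "before (stack_output [1, 3, 2] \<pi>) c a" "a < b" "b < c"
    by (auto simp: has_231_def)
  have "before (stack_output [1, 3, 2] \<pi>) b a"
    using w before_trans assms by (metis distinct_stack_output)
  moreover have "b \<in> set \<pi>" "c \<in> set \<pi>"
    using w by (auto dest!: before_in_set simp: stack_output_def)
  ultimately have "non_min \<pi> b" "non_min \<pi> c"
    using w output_after_min[OF assms, of b a] output_after_min[OF assms, of c a] by auto
  then show "\<exists>u v. ascent_pair \<pi> u v" using w by (auto simp: ascent_pair_def)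
next
  assume "\<exists>u v. ascent_pair \<pi> u v"
  then obtain u v where uv: "non_min \<pi> u" "non_min \<pi> v" "u < v"
    "before (stack_output [1, 3, 2] \<pi>) u v"
    by (auto simp: ascent_pair_def)
  obtain m where m: "before \<pi> m u" "m < u" "\<not> non_min \<pi> m"
    using non_min_above_min[OF assms uv(1)] by blast
  have mem: "m \<in> set \<pi>" using m by (auto dest: before_in_set)
  have "v \<in> set \<pi>" using uv(2) by (rule non_min_in_set)
  moreover have "m \<noteq> v" using m uv by auto
  ultimately have "before (stack_output [1, 3, 2] \<pi>) v m"
    using before_total[of m "stack_output [1, 3, 2] \<pi>" v] output_after_min[OF assms mem m(3), of v] mem uv(2)
    by (auto simp: stack_output_def)
  then show "has_231 (stack_output [1, 3, 2] \<pi>)"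
    using uv m by (auto simp: has_231_def)
qed

section \<open>Forbidden configurations\<close>

lemma split_before:
  assumes "distinct xs" "before xs u x"
  obtains ps qs where "xs = ps @ x # qs" "u \<in> set ps"
proof -
  have "x \<in> set xs" using assms(2) by (auto dest: before_in_set)
  then obtain ps qs where "xs = ps @ x # qs" using split_list by fast
  then show ?thesis using that assms by (auto dest: before_in_set)
qed

lemma output_order_when_popped:
  assumes "distinct (ps @ x # qs)" "u \<in> set ps" "u \<notin> set (settle x (stack_after ps))"
    and "v \<in> set (settle x (stack_after ps)) \<or> v = x \<or> v \<in> set qs"
  shows "before (stack_output [1, 3, 2] (ps @ x # qs)) u v"
  using output_order_popped[of u "ps @ [x]" v qs] assms by auto

lemma output_order_when_pushed:
  assumes "v \<in> set (settle x (stack_after ps))"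
  shows "before (stack_output [1, 3, 2] (ps @ x # qs)) x v"
  using output_order_stack[of "ps @ [x]" x v qs] assms by auto

text \<open>If both \<open>b\<close> and \<open>c\<close> were still on the stack when \<open>a\<close> is pushed, then \<open>a c b\<close> would be a 132 on it.
  Whichever of the two has been popped forms an ascent pair with \<open>d\<close>.\<close>

lemma contains_2314_imp_ascent_pair:
  assumes "distinct \<pi>" "contains \<pi> [2, 3, 1, 4]"
  shows "\<exists>u v. ascent_pair \<pi> u v"
proof -
  obtain b c a d where w: "before \<pi> b c" "before \<pi> c a" "before \<pi> a d" "a < b" "b < c" "c < d"
    using assms contains_2314 by blast
  obtain ps qs where \<pi>: "\<pi> = ps @ a # qs" "c \<in> set ps"
    using split_before[OF assms(1) w(2)] by blast
  have bc: "before ps b c" using w(1) \<pi> assms(1) before_prefix[of ps "a # qs" c b] by simp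
  then have b: "b \<in> set ps" by (auto dest: before_in_set)
  have d: "d \<in> set qs" using w(3) \<pi>(1) assms(1) by (auto dest: before_in_set)
  have "before \<pi> b d" using w before_trans[OF assms(1)] by blast
  then have nd: "non_min \<pi> d" using w by (auto simp: non_min_def)
  show ?thesis
  proof (cases "c \<in> set (settle a (stack_after ps))")
    case False
    have "non_min \<pi> c" using w by (auto simp: non_min_def)
    moreover have "before (stack_output [1, 3, 2] \<pi>) c d"
      unfolding \<pi>(1) using output_order_when_popped[of ps a qs c d] False \<pi> d assms(1) by blast
    ultimately show ?thesis using nd w(6) unfolding ascent_pair_def by blast
  next
    case True
    have "b \<notin> set (settle a (stack_after ps))"
    proof
      assume bs: "b \<in> set (settle a (stack_after ps))"
      have "\<not> before ps c b" using before_asym[of ps b c] bc assms(1) \<pi>(1) by simp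
      then have "before (settle a (stack_after ps)) c b"
        using before_total[OF True bs] w(5) before_settle before_stack_after by blast
      then show False using kept_avoids assms(1) \<pi>(1) w(4,5) by blast
    qed
    then have "before (stack_output [1, 3, 2] \<pi>) b d" "non_min \<pi> b"
      unfolding \<pi>(1)
      using output_order_when_popped[of ps a qs b d] popped_non_min[of ps a qs b] b d assms(1) \<pi>(1)
      by blast+
    moreover have "b < d" using w(5,6) by simp
    ultimately show ?thesis using nd unfolding ascent_pair_def by blast
  qed
qed

text \<open>If \<open>c\<close> has been popped before \<open>b\<close> enters, the responsible letter \<open>x\<close> is \<open>b\<close> or comes between \<open>c\<close>
  and \<open>b\<close>, so \<open>b \<le> x\<close> by the shading there. The last entry \<open>l\<close> popped for \<open>x\<close> is the informative
  one: the witness \<open>y\<close> for its pop is still on the stack, below \<open>x\<close> and larger than \<open>x\<close>.\<close>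

lemma mesh_contains_mu_imp_ascent_pair:
  assumes "distinct \<pi>" "mesh_contains \<pi> mu"
  shows "\<exists>u v. ascent_pair \<pi> u v"
proof -
  obtain a c b where w: "before \<pi> a c" "before \<pi> c b" "a < b" "b < c"
    and left: "\<And>y. before \<pi> y a \<Longrightarrow> y < b \<or> c < y"
    and mid: "\<And>y. before \<pi> c y \<Longrightarrow> before \<pi> y b \<Longrightarrow> b < y"
    using assms mesh_contains_mu_iff_before by metis
  have ab: "before \<pi> a b" using w before_trans[OF assms(1)] by blast
  have nb: "non_min \<pi> b" and nc: "non_min \<pi> c" using w ab by (auto simp: non_min_def)
  obtain ps qs where \<pi>: "\<pi> = ps @ b # qs" "c \<in> set ps"
    using split_before[OF assms(1) w(2)] by blast
  show ?thesis
  proof (cases "c \<in> set (settle b (stack_after ps))")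
    case True
    then have "before (stack_output [1, 3, 2] \<pi>) b c"
      unfolding \<pi>(1) by (rule output_order_when_pushed)
    then show ?thesis using w(4) nb nc unfolding ascent_pair_def by blast
  next
    case False
    have "c \<noteq> b" using w by simp
    then obtain ps' x rs where p: "ps @ [b] = ps' @ x # rs" "c \<in> set (stack_after ps')"
      "c \<notin> set (settle x (stack_after ps'))"
      using popped_at_some_time[of c "ps @ [b]"] \<pi>(2) False by auto
    have \<pi>': "\<pi> = ps' @ x # rs @ qs" using \<pi>(1) p(1) by (metis append.assoc append_Cons append_Nil)
    have cps': "c \<in> set ps'" using p(2) set_stack_after by blast
    have cx: "before \<pi> c x" using \<pi>' cps' by simp
    have "x = b \<or> before \<pi> x b"
    proof (cases rs rule: rev_exhaust)
      case Nil
      then show ?thesis using p(1) by simp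
    next
      case (snoc rs' y)
      then show ?thesis using p(1) \<pi>' by simp
    qed
    then have bx: "b \<le> x" using mid[OF cx] by auto
    have ax: "before \<pi> a x" using w(1) cx before_trans[OF assms(1)] by blast
    have nx: "non_min \<pi> x" using ax bx w(3) by (auto simp: non_min_def)
    define S where "S = settle x (stack_after ps')"
    obtain us where us: "stack_after ps' = us @ S" using settle_suffix S_def by metis
    have "c \<notin> set S" using p(3) S_def by blast
    then have cus: "c \<in> set us" using us p(2) by simp
    then obtain us' l where us': "us = us' @ [l]" by (metis empty_iff list.set(1) rev_exhaust)
    have dps': "distinct ps'" using assms(1) \<pi>' by simp
    have "distinct (us @ S)" using us distinct_stack_after[OF dps'] by simp
    then have lS: "l \<notin> set S" using us' by simp
    have l: "l \<in> set (stack_after ps')" using us us' by simp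
    have dx: "distinct (ps' @ [x])" using assms(1) \<pi>' by simp
    obtain z y where zy: "z = l \<or> before (stack_after ps') l z" "before (stack_after ps') z y"
      "x < y" "y < z"
      using popped_witness[OF dx l] lS S_def by blast
    have after_l: "before (stack_after ps') l t \<longleftrightarrow> t \<in> set S" for t
      using \<open>distinct (us @ S)\<close> us us' by (auto dest: before_in_set)
    have yS: "y \<in> set S"
      using zy after_l before_trans[OF distinct_stack_after[OF dps']] by blast
    \<comment> \<open>After the pop no 132 starts with \<open>x\<close>, so the forcing occurrence has to use \<open>l\<close>.\<close>
    have zl: "z = l"
    proof (rule ccontr)
      assume "z \<noteq> l"
      then have "z \<in> set S" using zy after_l by blast
      moreover have "before S z y"
        using \<open>z \<in> set S\<close> yS zy(2,4) before_total[of z S y] before_asym[OF distinct_stack_after[OF dps']]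
        us by (metis before_append less_irrefl)
      ultimately show False using kept_avoids assms(1) \<pi>' zy(3,4) S_def by blast
    qed
    have lps: "l \<in> set ps'" using l set_stack_after by blast
    have nl: "non_min \<pi> l"
      unfolding \<pi>'
    proof (rule popped_non_min)
      show "distinct (ps' @ x # rs @ qs)" using assms(1) \<pi>' by simp
      show "l \<notin> set (settle x (stack_after ps'))" using lS S_def by blast
    qed (rule lps)
    show ?thesis
    proof (cases "non_min \<pi> y")
      case True
      have "before (stack_output [1, 3, 2] \<pi>) x y"
        unfolding \<pi>' using yS S_def output_order_when_pushed by blast
      then show ?thesis using True nx zy(3) unfolding ascent_pair_def by blast
    next
      case False
      \<comment> \<open>A left-to-right minimum larger than \<open>a\<close> precedes \<open>a\<close>, where values from \<open>b\<close> to \<open>c\<close> are shaded.\<close>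
      have "a < y" using w(3) bx zy(3) by simp
      then have "\<not> before \<pi> a y" using False by (auto simp: non_min_def)
      moreover have "y \<in> set ps'" using yS set_settle set_stack_after unfolding S_def by blast
      then have "y \<in> set \<pi>" using \<pi>' by simp
      moreover have "a \<in> set \<pi>" using w(1) by (auto dest: before_in_set)
      ultimately have "before \<pi> y a" using before_total[of y \<pi> a] \<open>a < y\<close> by auto
      then have "c < y" using left[of y] bx zy(3) by auto
      then have "c < l" using zy(4) zl by simp
      then have "c \<in> set us'" using cus us' by auto
      then have "before (stack_after ps') c l" using us us' by simp
      then have "before (stack_output [1, 3, 2] \<pi>) c l"
        unfolding \<pi>' by (rule output_order_stack)
      then show ?thesis using nc nl \<open>c < l\<close> unfolding ascent_pair_def by blast
    qed
  qed
qed

text \<open>The entry \<open>u\<close> above \<open>v\<close> guarantees that \<open>v\<close> stays on the stack until the first smaller entry \<open>w\<close> arrives; choosing the first one makes the shaded region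
  between \<open>v\<close> and \<open>w\<close> empty. The left end of the pattern is the smallest entry before \<open>v\<close>.\<close>

lemma larger_below_imp_pattern:
  assumes "distinct \<pi>" "\<pi> = ps @ xs" "before (stack_after ps) u v" "u < v" "non_min \<pi> v"
  shows "contains \<pi> [2, 3, 1, 4] \<or> mesh_contains \<pi> mu"
proof -
  have dps: "distinct ps" using assms(1,2) by simp
  have "before ps v u" using assms(3) by (rule before_stack_after)
  then obtain As Bs where AB: "ps = As @ v # Bs" "u \<in> set Bs" using before_split by fast
  then obtain Bs1 w Bs2 where B: "Bs = Bs1 @ w # Bs2" "w < v" "\<forall>y\<in>set Bs1. \<not> y < v"
    using split_list_first_prop[of Bs "\<lambda>y. y < v"] assms(4) by metis
  define P where "P = As @ v # Bs1"
  have \<pi>: "\<pi> = P @ w # Bs2 @ xs" using assms(2) AB B P_def by simp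
  have vP: "v \<in> set P" using P_def by simp
  have "v \<in> set (stack_after ps)" using assms(3) by (auto dest: before_in_set)
  then have "v \<in> set (stack_after ((P @ [w]) @ Bs2))" using AB B P_def by simp
  then have "v \<in> set (stack_after (P @ [w]))"
    using stack_after_antimono[of "P @ [w]" Bs2 v] dps AB B P_def by simp
  then have vw: "v \<in> set (settle w (stack_after P))" using B(2) by auto
  \<comment> \<open>The pattern needs \<open>m < w\<close>: as \<open>v\<close> survives the arrival of \<open>w\<close>, \<open>w\<close> is not a new minimum.\<close>
  have "non_min \<pi> w" using minimum_keeps_only_minima[of P w "Bs2 @ xs" v] vw assms(1,5) \<pi> by simp
  then have "non_min (P @ [w]) w"
    using non_min_prefix[of "P @ [w]" "Bs2 @ xs" w] assms(1) \<pi> by simp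
  then obtain y0 where y0: "y0 \<in> set P" "y0 < w"
    using assms(1) \<pi> by (auto simp: non_min_def dest: before_in_set)
  have big: "w < y" if "y \<in> set (v # Bs1)" for y
    using that B(2,3) by (auto simp: not_less)
  have y0A: "y0 \<in> set As" using y0 big P_def by fastforce
  define m where "m = Min (set As)"
  have mA: "m \<in> set As" using y0A m_def by (auto intro: Min_in)
  have mle: "m \<le> y" if "y \<in> set As" for y using that m_def by simp
  have mw: "m < w" using mle[OF y0A] y0(2) by simp
  have mv: "before \<pi> m v" using \<pi> P_def mA by simp
  have vw': "before \<pi> v w" using \<pi> P_def by simp
  show ?thesis
  proof (cases "\<exists>y. before \<pi> y m \<and> w < y \<and> y < v")
    case True
    then obtain y where y: "before \<pi> y m" "w < y" "y < v" by blast
    have yA: "before As y m" using y(1) \<pi> P_def mA assms(1) by (auto dest: before_in_set)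
    then have yAs: "y \<in> set As" by (auto dest: before_in_set)
    \<comment> \<open>On the stack, \<open>y\<close> would lie below \<open>v\<close> and give the 132 \<open>w v y\<close>. Popped entries are non-minima.\<close>
    have "y \<notin> set (settle w (stack_after P))"
    proof
      assume ys: "y \<in> set (settle w (stack_after P))"
      have "before P y v" using P_def yAs by simp
      then have "\<not> before P v y" using before_asym assms(1) \<pi> by (metis distinct_append)
      moreover have "before (settle w (stack_after P)) v y \<or> before (settle w (stack_after P)) y v"
        using before_total[OF vw ys] y(3) by auto
      ultimately have "before (settle w (stack_after P)) v y"
        using \<open>before P y v\<close> before_settle before_stack_after by blast
      then show False using kept_avoids assms(1) \<pi> y(2,3) by blast
    qed
    moreover have "y \<in> set P" using yAs P_def by simp
    ultimately have "non_min \<pi> y" using popped_non_min assms(1) \<pi> by blast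
    then obtain m' where m': "before \<pi> m' y" "m' < y" by (auto simp: non_min_def)
    have "m' \<in> set As" using m'(1) yAs \<pi> P_def assms(1) by (auto dest: before_in_set)
    moreover have "m' \<noteq> m" using m'(1) y(1) before_asym[OF assms(1)] by blast
    ultimately have "m < m'" using mle[of m'] by simp
    then have "contains \<pi> [2, 3, 1, 4]"
      unfolding contains_2314[OF assms(1)] using m' y mv by blast
    then show ?thesis by blast
  next
    case False
    have "y < w \<or> v < y" if "before \<pi> y m" for y
    proof -
      have "y \<in> set As" using that \<pi> P_def mA assms(1) by (auto dest: before_in_set)
      then have "y \<noteq> w" "y \<noteq> v" using assms(1) \<pi> P_def by auto
      then show ?thesis using False that by (metis linorder_neqE_nat)
    qed
    moreover have "w < y" if "before \<pi> v y" "before \<pi> y w" for y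
    proof -
      have "y \<in> set Bs1" using that \<pi> P_def assms(1) by (auto dest: before_in_set)
      then show ?thesis using big by simp
    qed
    ultimately have "mesh_contains \<pi> mu"
      unfolding mesh_contains_mu_iff_before[OF assms(1)] using mv vw' mw B(2) by blast
    then show ?thesis by blast
  qed
qed

text \<open>If \<open>v\<close> precedes \<open>u\<close> in the input, it must still be on the stack when \<open>u\<close> enters. Otherwise \<open>u\<close> is
  popped before \<open>v\<close> enters, and everything depends on the witness \<open>z\<close> of this pop: \<open>z \<le> u < v\<close> yields a
  2314, and \<open>z > u\<close> is a larger entry below \<open>u\<close>.\<close>

lemma ascent_pair_imp_pattern:
  assumes "distinct \<pi>" "ascent_pair \<pi> u v"
  shows "contains \<pi> [2, 3, 1, 4] \<or> mesh_contains \<pi> mu"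
proof -
  have uv: "non_min \<pi> u" "non_min \<pi> v" "u < v" "before (stack_output [1, 3, 2] \<pi>) u v"
    using assms(2) unfolding ascent_pair_def by blast+
  have asym: "\<not> before (stack_output [1, 3, 2] \<pi>) v u"
    using before_asym[OF _ uv(4)] assms(1) by simp
  consider "before \<pi> v u" | "before \<pi> u v"
    using before_total[OF non_min_in_set[OF uv(1)] non_min_in_set[OF uv(2)]] uv(3) by blast
  then show ?thesis
  proof cases
    case 1
    then obtain ps qs where \<pi>: "\<pi> = ps @ u # qs" "v \<in> set ps"
      using split_before[OF assms(1)] by blast
    have "v \<in> set (settle u (stack_after ps))"
      using output_order_when_popped[of ps u qs v u] asym assms(1) unfolding \<pi>(1)
      using \<pi>(2) by blast
    then have "before (stack_after (ps @ [u])) u v" by simp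
    then show ?thesis using larger_below_imp_pattern[of \<pi> "ps @ [u]" qs u v] assms(1) \<pi> uv by simp
  next
    case 2
    then obtain ps qs where \<pi>: "\<pi> = ps @ v # qs" "u \<in> set ps"
      using split_before[OF assms(1)] by blast
    have "u \<notin> set (settle v (stack_after ps))"
      using output_order_when_pushed[of u v ps qs] before_asym[OF _ uv(4)] assms(1) \<pi>(1) by auto
    then have "u \<notin> set (stack_after (ps @ [v]))" using uv(3) by simp
    then obtain ps' x rs where p: "ps @ [v] = ps' @ x # rs" "u \<in> set (stack_after ps')"
      "u \<notin> set (settle x (stack_after ps'))"
      using popped_at_some_time[of u "ps @ [v]"] \<pi>(2) by auto
    have \<pi>': "\<pi> = ps' @ x # rs @ qs" using \<pi>(1) p(1) by (metis append.assoc append_Cons append_Nil)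
    have dx: "distinct (ps' @ [x])" using assms(1) \<pi>' by simp
    obtain z y where zy: "z = u \<or> before (stack_after ps') u z" "before (stack_after ps') z y"
      "x < y" "y < z"
      using popped_witness[OF dx p(2,3)] by blast
    show ?thesis
    proof (cases "u < z")
      case True
      then have uz: "before (stack_after ps') u z" using zy(1) by auto
      have "before \<pi> y z" using before_stack_after[OF zy(2)] \<pi>' by simp
      then have "non_min \<pi> z" using zy(4) by (auto simp: non_min_def)
      then show ?thesis
        using larger_below_imp_pattern[OF assms(1) \<pi>' uz True] by blast
    next
      case False
      have "before \<pi> y z" using before_stack_after[OF zy(2)] \<pi>' by simp
      moreover have "before \<pi> z x"
        using zy(2) set_stack_after \<pi>' by (auto dest!: before_in_set)
      moreover have "x \<noteq> v" using zy False uv(3) by auto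
      then have "before \<pi> x v"
        using p(1) \<pi>' by (cases rs rule: rev_exhaust) auto
      moreover have "z < v" using False uv(3) by simp
      ultimately have "contains \<pi> [2, 3, 1, 4]"
        unfolding contains_2314[OF assms(1)] using zy(3,4) by blast
      then show ?thesis by blast
    qed
  qed
qed

theorem theorem5p3:
  shows "Sort [1, 3, 2] = {\<pi> \<in> perms. \<not> contains \<pi> [2, 3, 1, 4] \<and> \<not> mesh_contains \<pi> mu}"
proof -
  have "stack_output [2, 1] (stack_output [1, 3, 2] \<pi>) = [1..<Suc (length \<pi>)] \<longleftrightarrow>
      \<not> contains \<pi> [2, 3, 1, 4] \<and> \<not> mesh_contains \<pi> mu" if \<pi>: "\<pi> \<in> perms" for \<pi>
  proof -
    obtain n where n: "distinct \<pi>" "set \<pi> = {1..n}"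
      using \<pi> unfolding perms_def permutations_of_set_def by blast
    then have "length \<pi> = n" using distinct_card[OF n(1)] by simp
    have "distinct (stack_output [1, 3, 2] \<pi>)" using n(1) by simp
    moreover have "set (stack_output [1, 3, 2] \<pi>) = {1..n}"
      unfolding stack_output_def set_stack_run n(2) by simp
    ultimately have "stack_output [2, 1] (stack_output [1, 3, 2] \<pi>) = [1..<Suc (length \<pi>)] \<longleftrightarrow>
        \<not> has_231 (stack_output [1, 3, 2] \<pi>)"
      unfolding \<open>length \<pi> = n\<close> by (rule stack_output_21_sorts_iff)
    also have "\<dots> \<longleftrightarrow> (\<nexists>u v. ascent_pair \<pi> u v)"
      using output_has_231_iff n(1) by blast
    also have "\<dots> \<longleftrightarrow> \<not> contains \<pi> [2, 3, 1, 4] \<and> \<not> mesh_contains \<pi> mu"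
      using contains_2314_imp_ascent_pair mesh_contains_mu_imp_ascent_pair
        ascent_pair_imp_pattern n(1) by blast
    finally show ?thesis .
  qed
  then show ?thesis unfolding Sort_def by blast
qed

end
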